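(* Let $(X,\mathcal{T})$ be a topological space and let $\mathcal{T}^{\alpha}$ be the topology on $X$ consisting of all $\alpha$-sets of $(X,\mathcal{T})$. Then $(X,\mathcal{T}^{\alpha})$ is para-$rc$-Lindelöf if and only if $(X,\mathcal{T})$ is para-$rc$-Lindelöf.
   Context: No separation axioms are assumed. Let $A\subseteq X$, with interior $\mathrm{Int}\,A$ and closure $\mathrm{Cl}\,A$ in $(X,\mathcal{T})$. The set $A$ is regular open if $A=\mathrm{Int}(\mathrm{Cl}\,A)$; regular closed if its complement is regular open (equivalently $A=\mathrm{Cl}(\mathrm{Int}\,A)$); an $\alpha$-set if $A\subseteq \mathrm{Int}(\mathrm{Cl}(\mathrm{Int}\,A))$. The collection $\mathcal{T}^{\alpha}$ of all $\alpha$-sets is a topology on $X$ finer than $\mathcal{T}$ (Njåstad). A space is para-$rc$-Lindelöf if every cover of it by regular closed sets has a locally countable refinement by regular closed sets. Here a refinement is a cover each of whose members is contained in some member of the original cover, and a family is locally countable if each point has a neighbourhood meeting at most countably many members of the family. All notions for $(X,\mathcal{T}^{\alpha})$ are taken with respect to $\mathcal{T}^{\alpha}$. *)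

theory Defs
  imports "HOL-Analysis.Analysis"
begin

definition regular_openin :: "'a topology \<Rightarrow> 'a set \<Rightarrow> bool" where
  "regular_openin X A \<longleftrightarrow> A = X interior_of (X closure_of A)"

definition regular_closedin :: "'a topology \<Rightarrow> 'a set \<Rightarrow> bool" where
  "regular_closedin X A \<longleftrightarrow> A \<subseteq> topspace X \<and> regular_openin X (topspace X - A)"

definition alpha_set_in :: "'a topology \<Rightarrow> 'a set \<Rightarrow> bool" where
  "alpha_set_in X A \<longleftrightarrow> A \<subseteq> X interior_of (X closure_of (X interior_of A))"

definition alpha_topology :: "'a topology \<Rightarrow> 'a topology" where
  "alpha_topology X = topology (alpha_set_in X)"

text \<open>Analogue of \<^const>\<open>locally_finite_in\<close>. Restricting to open neighbourhoods loses nothing,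
  as the countability condition passes to smaller neighbourhoods.\<close>

definition locally_countable_in :: "'a topology \<Rightarrow> 'a set set \<Rightarrow> bool" where
  "locally_countable_in X \<A> \<longleftrightarrow>
     \<Union>\<A> \<subseteq> topspace X \<and>
     (\<forall>x \<in> topspace X. \<exists>V. openin X V \<and> x \<in> V \<and> countable {U \<in> \<A>. U \<inter> V \<noteq> {}})"

definition covers_space :: "'a topology \<Rightarrow> 'a set set \<Rightarrow> bool" where
  "covers_space X \<U> \<longleftrightarrow> \<Union>\<U> = topspace X"

definition refinement_in :: "'a topology \<Rightarrow> 'a set set \<Rightarrow> 'a set set \<Rightarrow> bool" where
  "refinement_in X \<V> \<U> \<longleftrightarrow> covers_space X \<V> \<and> (\<forall>V \<in> \<V>. \<exists>U \<in> \<U>. V \<subseteq> U)"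

definition para_rc_Lindelof_space :: "'a topology \<Rightarrow> bool" where
  "para_rc_Lindelof_space X \<longleftrightarrow>
     (\<forall>\<U>. covers_space X \<U> \<and> (\<forall>U \<in> \<U>. regular_closedin X U) \<longrightarrow>
        (\<exists>\<V>. refinement_in X \<V> \<U> \<and> (\<forall>V \<in> \<V>. regular_closedin X V) \<and>
             locally_countable_in X \<V>))"

text \<open>The function \<^const>\<open>topology\<close> is unspecified on predicates that are not topologies, so
  \<^const>\<open>alpha_topology\<close> only has its intended meaning thanks to the next two lemmas.\<close>

lemma istopology_alpha_set_in: "istopology (alpha_set_in X)"
  unfolding istopology_def
proof (intro conjI allI impI)
  fix S T assume S: "alpha_set_in X S" and T: "alpha_set_in X T"
  define U where "U = X interior_of S"
  define V where "V = X interior_of T"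
  define W where "W = X interior_of (X closure_of U) \<inter> X interior_of (X closure_of V)"
  have oU: "openin X U" and oV: "openin X V" and oW: "openin X W"
    by (auto simp: U_def V_def W_def)
  have WU: "W \<subseteq> X closure_of U" and WV: "W \<subseteq> X closure_of V"
    unfolding W_def using interior_of_subset by fast+
  have "W \<subseteq> X closure_of (U \<inter> V)"
  proof
    fix x assume x: "x \<in> W"
    have "\<exists>y \<in> U \<inter> V. y \<in> N" if N: "x \<in> N" "openin X N" for N
    proof -
      have "openin X (N \<inter> W)" using N oW by blast
      moreover have "x \<in> N \<inter> W" using N x by blast
      moreover have "x \<in> X closure_of U" using x WU by blast
      ultimately obtain y where y: "y \<in> U" "y \<in> N \<inter> W"
        unfolding in_closure_of by blast
      have "openin X (N \<inter> U)" using N oU by blast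
      moreover have "y \<in> N \<inter> U" using y by blast
      moreover have "y \<in> X closure_of V" using y WV by blast
      ultimately show ?thesis
        unfolding in_closure_of by blast
    qed
    moreover have "x \<in> topspace X" using x oW openin_subset by blast
    ultimately show "x \<in> X closure_of (U \<inter> V)"
      unfolding in_closure_of by blast
  qed
  then have "W \<subseteq> X interior_of (X closure_of (U \<inter> V))"
    using oW interior_of_maximal by blast
  moreover have "S \<inter> T \<subseteq> W"
    using S T by (auto simp: alpha_set_in_def W_def U_def V_def)
  ultimately show "alpha_set_in X (S \<inter> T)"
    by (simp add: alpha_set_in_def U_def V_def interior_of_Int)
next
  fix \<K> assume K: "\<forall>K \<in> \<K>. alpha_set_in X K"
  have "K \<subseteq> X interior_of (X closure_of (X interior_of (\<Union>\<K>)))" if "K \<in> \<K>" for K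
  proof -
    have "X interior_of (X closure_of (X interior_of K))
          \<subseteq> X interior_of (X closure_of (X interior_of (\<Union>\<K>)))"
      using that by (intro interior_of_mono closure_of_mono) auto
    then show ?thesis using K that unfolding alpha_set_in_def by blast
  qed
  then show "alpha_set_in X (\<Union>\<K>)"
    unfolding alpha_set_in_def by blast
qed

lemma openin_alpha_topology: "openin (alpha_topology X) = alpha_set_in X"
  by (simp add: alpha_topology_def istopology_alpha_set_in)

end

theory Submission
  imports Defs
begin

text \<open>
  The spaces \<open>X\<close> and \<open>alpha_topology X\<close> have the same regular closed sets
  (lemma \<open>regular_closedin_alpha_topology\<close>), and a family of such sets is locally countable in
  one space iff it is in the other (lemma \<open>locally_countable_in_alpha_topology_iff\<close>). The
  notions of cover and refinement depend only on the underlying set, so the two spaces have the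
  same covers by regular closed sets and the same locally countable refinements of them.

  Both facts come from one observation. An \<open>\<alpha>\<close>-set \<open>A\<close> lies in the open set
  \<open>Int (Cl (Int A))\<close>, its open hull, in which \<open>Int A\<close> is dense. Hence an open set that meets the
  hull already meets \<open>Int A\<close> (lemma \<open>open_meets_hull_imp_meets_interior\<close>). For closures and
  interiors this means that the two topologies agree on the closures of \<open>\<alpha>\<close>-sets and on the
  interiors of closed sets, and these are the only ones needed to decide whether an \<open>\<alpha>\<close>-set is
  regular open. For local countability it means that an \<open>\<alpha>\<close>-neighbourhood and its hull, which is an
  ordinary neighbourhood, meet the same regular closed sets.
\<close>

lemma alpha_set_in_openin:
  assumes "openin X U"
  shows "alpha_set_in X U"
  unfolding alpha_set_in_def
  using assms by (simp add: interior_of_openin interior_of_maximal closure_of_subset openin_subset)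

lemma topspace_alpha_topology [simp]: "topspace (alpha_topology X) = topspace X"
proof
  have "alpha_set_in X (topspace (alpha_topology X))"
    using openin_topspace openin_alpha_topology by metis
  then show "topspace (alpha_topology X) \<subseteq> topspace X"
    unfolding alpha_set_in_def using interior_of_subset_topspace by fast
  have "openin (alpha_topology X) (topspace X)"
    by (simp add: openin_alpha_topology alpha_set_in_openin)
  then show "topspace X \<subseteq> topspace (alpha_topology X)"
    by (rule openin_subset)
qed

lemma open_meets_hull_imp_meets_interior:
  assumes "openin X W" "W \<inter> X interior_of (X closure_of (X interior_of A)) \<noteq> {}"
  shows "W \<inter> X interior_of A \<noteq> {}"
proof -
  have "W \<inter> X closure_of (X interior_of A) \<noteq> {}"
    using assms(2) interior_of_subset by fast
  then show ?thesis
    using assms(1) by (simp add: openin_Int_closure_of_eq_empty)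
qed

text \<open>
  An \<open>\<alpha>\<close>-neighbourhood \<open>N\<close> of a point of \<open>Cl A\<close> meets \<open>A\<close> because the observation on hulls
  applies twice: the hull of \<open>N\<close> is open and meets \<open>A\<close>, so it meets \<open>Int A\<close>; now \<open>Int A\<close> is
  open and meets the hull of \<open>N\<close>, so it meets \<open>Int N\<close>.
\<close>

lemma closure_of_alpha_topology:
  assumes "alpha_set_in X A"
  shows "alpha_topology X closure_of A = X closure_of A"
proof
  show "alpha_topology X closure_of A \<subseteq> X closure_of A"
    unfolding closure_of_def by (auto simp: openin_alpha_topology alpha_set_in_openin)
  show "X closure_of A \<subseteq> alpha_topology X closure_of A"
  proof
    fix x assume x: "x \<in> X closure_of A"
    have "\<exists>y. y \<in> A \<and> y \<in> N" if N: "x \<in> N" "alpha_set_in X N" for N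
    proof -
      let ?H = "X interior_of (X closure_of (X interior_of N))"
      have "x \<in> ?H"
        using N by (auto simp: alpha_set_in_def)
      then have "?H \<inter> A \<noteq> {}"
        using x openin_Int_closure_of_eq_empty[of X ?H A] by auto
      then have "?H \<inter> X interior_of (X closure_of (X interior_of A)) \<noteq> {}"
        using assms by (auto simp: alpha_set_in_def)
      then have "?H \<inter> X interior_of A \<noteq> {}"
        by (rule open_meets_hull_imp_meets_interior[OF openin_interior_of])
      then have "X interior_of A \<inter> X interior_of N \<noteq> {}"
        using open_meets_hull_imp_meets_interior[OF openin_interior_of, of X A N]
        by (simp add: Int_commute)
      then show ?thesis
        using interior_of_subset by fast
    qed
    moreover have "x \<in> topspace X"
      using x by (simp add: in_closure_of)
    ultimately show "x \<in> alpha_topology X closure_of A"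
      by (auto simp: in_closure_of openin_alpha_topology)
  qed
qed

text \<open>
  Dual to the previous lemma: the complement of a closed set is open, hence an \<open>\<alpha>\<close>-set, so its
  closure is the same in both topologies.
\<close>

lemma interior_of_alpha_topology:
  assumes "closedin X C"
  shows "alpha_topology X interior_of C = X interior_of C"
proof -
  have "alpha_set_in X (topspace X - C)"
    using assms by (intro alpha_set_in_openin) (simp add: closedin_def)
  then show ?thesis
    by (simp add: interior_of_closure_of closure_of_alpha_topology)
qed

lemma regular_openin_alpha_topology:
  "regular_openin (alpha_topology X) A \<longleftrightarrow> regular_openin X A"
proof (cases "alpha_set_in X A")
  case True
  then show ?thesis
    by (simp add: regular_openin_def closure_of_alpha_topology interior_of_alpha_topology)
next
  \<comment> \<open>A set that is regular open in either space is open there, and so an \<open>\<alpha>\<close>-set.\<close>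
  case False
  then have "\<not> regular_openin (alpha_topology X) A"
    unfolding regular_openin_def by (metis openin_alpha_topology openin_interior_of)
  moreover have "\<not> regular_openin X A"
    using False unfolding regular_openin_def by (metis alpha_set_in_openin openin_interior_of)
  ultimately show ?thesis by simp
qed

lemma regular_closedin_alpha_topology:
  "regular_closedin (alpha_topology X) = regular_closedin X"
  by (simp add: fun_eq_iff regular_closedin_def regular_openin_alpha_topology)

lemma regular_closedin_eq_closure_of_interior:
  assumes "regular_closedin X F"
  shows "F = X closure_of (X interior_of F)"
proof -
  have "F \<subseteq> topspace X"
    and "topspace X - F = X interior_of (X closure_of (topspace X - F))"
    using assms by (auto simp: regular_closedin_def regular_openin_def)
  then have "topspace X - F = topspace X - X closure_of (X interior_of F)"
    by (simp add: closure_of_complement interior_of_complement)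
  with \<open>F \<subseteq> topspace X\<close> show ?thesis
    using closure_of_subset_topspace[of X "X interior_of F"] by blast
qed

text \<open>
  Regularity of the members is essential: a neighbourhood in the finer topology may avoid a set
  that its hull meets. For \<open>F = Cl (Int F)\<close> this cannot happen, since the hull then meets the
  open set \<open>Int F\<close>, which therefore meets the interior of the \<open>\<alpha>\<close>-neighbourhood.
\<close>

lemma locally_countable_in_alpha_topology_iff:
  assumes "\<And>F. F \<in> \<V> \<Longrightarrow> regular_closedin X F"
  shows "locally_countable_in (alpha_topology X) \<V> \<longleftrightarrow> locally_countable_in X \<V>"
proof
  assume "locally_countable_in X \<V>"
  then show "locally_countable_in (alpha_topology X) \<V>"
    unfolding locally_countable_in_def topspace_alpha_topology openin_alpha_topology
    using alpha_set_in_openin by metis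
next
  assume L: "locally_countable_in (alpha_topology X) \<V>"
  have "\<exists>W. openin X W \<and> x \<in> W \<and> countable {F \<in> \<V>. F \<inter> W \<noteq> {}}" if "x \<in> topspace X" for x
  proof -
    have "\<exists>N. alpha_set_in X N \<and> x \<in> N \<and> countable {F \<in> \<V>. F \<inter> N \<noteq> {}}"
      using L that
      unfolding locally_countable_in_def openin_alpha_topology topspace_alpha_topology by simp
    then obtain N where N: "alpha_set_in X N" "x \<in> N" "countable {F \<in> \<V>. F \<inter> N \<noteq> {}}"
      by (elim exE conjE)
    let ?H = "X interior_of (X closure_of (X interior_of N))"
    have "F \<inter> N \<noteq> {}" if "F \<in> \<V>" "F \<inter> ?H \<noteq> {}" for F
    proof -
      have "?H \<inter> X closure_of (X interior_of F) \<noteq> {}"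
        using that(2) regular_closedin_eq_closure_of_interior[OF assms[OF that(1)]]
        by (simp add: Int_commute)
      then have "X interior_of F \<inter> ?H \<noteq> {}"
        using openin_Int_closure_of_eq_empty[of X ?H "X interior_of F"] by auto
      then have "X interior_of F \<inter> X interior_of N \<noteq> {}"
        by (rule open_meets_hull_imp_meets_interior[OF openin_interior_of])
      then show ?thesis
        using interior_of_subset by fast
    qed
    then have "countable {F \<in> \<V>. F \<inter> ?H \<noteq> {}}"
      by (intro countable_subset[OF _ N(3)]) blast
    moreover have "x \<in> ?H"
      using N by (auto simp: alpha_set_in_def)
    ultimately show ?thesis
      by (intro exI[of _ ?H]) simp
  qed
  then show "locally_countable_in X \<V>"
    using L by (simp add: locally_countable_in_def)
qed

theorem theorem2p8:
  fixes X :: "'a topology"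
  shows "para_rc_Lindelof_space (alpha_topology X) \<longleftrightarrow> para_rc_Lindelof_space X"
proof -
  have covers: "covers_space (alpha_topology X) = covers_space X"
    by (simp add: fun_eq_iff covers_space_def)
  have refines: "refinement_in (alpha_topology X) = refinement_in X"
    by (simp add: fun_eq_iff refinement_in_def covers)
  show ?thesis
    unfolding para_rc_Lindelof_space_def covers refines regular_closedin_alpha_topology
    by (metis locally_countable_in_alpha_topology_iff)
qed

end
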